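(* Let $\Omega\subset\mathbb{R}^n$ be a bounded, convex, open set, let $\Gamma$ be a convex, open subset of the space $\mathrm{Sym}^{n\times n}$ of real symmetric $n\times n$ matrices, and let $f:\mathbb{R}^n\times\Gamma\to\mathbb{R}$ and $b:\Omega\times\mathbb{R}\times\mathbb{R}^n\to\mathbb{R}$ be functions satisfying the following conditions. (i) Weak ellipticity: for all $p\in\mathbb{R}^n$ and $r,s\in\Gamma$, if $r\ge s$ then $f(p,r)\ge f(p,s)$. (ii) Concavity: for all $p\in\mathbb{R}^n$, $r,s\in\Gamma$ and $\lambda\in[0,1]$, $f(p,\lambda r+(1-\lambda)s)\ge\lambda f(p,r)+(1-\lambda)f(p,s)$. (iii) Monotonicity: for all $x\in\Omega$, $p\in\mathbb{R}^n$ and $z,w\in\mathbb{R}$, if $z>w$ then $b(x,z,p)<b(x,w,p)$. (iv) Joint concavity: for all $x,y\in\Omega$, $z,w\in\mathbb{R}$, $p\in\mathbb{R}^n$ and $\lambda\in[0,1]$, $b(\lambda x+(1-\lambda)y,\lambda z+(1-\lambda)w,p)\ge\lambda b(x,z,p)+(1-\lambda)b(y,w,p)$. Suppose that $u\in C^1(\overline\Omega)$ is twice differentiable in $\Omega$, with $D^2u(x)\in\Gamma$ for every $x\in\Omega$, and satisfies $$-f(Du(x),D^2u(x))=b(x,u(x),Du(x))\quad\text{for all }x\in\Omega.$$ If the graph of $u$ lies below its boundary tangent hyperplanes, then $u$ is concave.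
   Context: For symmetric matrices, $r\ge s$ means that $r-s$ is positive semi-definite. The graph of $u$ "lies below its boundary tangent hyperplanes" means: for every $x\in\partial\Omega$ and every $y\in\overline\Omega\setminus\{x\}$, $u(y)<u(x)+Du(x)\cdot(y-x)$. No regularity (e.g. continuity) is assumed of $f$ or $b$. *)

theory Defs
  imports "HOL-Analysis.Analysis"
begin

definition sym_matrices :: "(real ^ 'n ^ 'n) set" where
  "sym_matrices = {A. transpose A = A}"

definition psd :: "real ^ 'n ^ 'n \<Rightarrow> bool" where
  "psd A \<longleftrightarrow> A \<in> sym_matrices \<and> (\<forall>v. 0 \<le> v \<bullet> (A *v v))"

text \<open>The order on symmetric matrices. The library's order on vector types is componentwise
  and must not be used here.\<close>

definition loewner_le :: "real ^ 'n ^ 'n \<Rightarrow> real ^ 'n ^ 'n \<Rightarrow> bool" where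
  "loewner_le s r \<longleftrightarrow> psd (r - s)"

text \<open>\<open>u\<close> belongs to $C^1(\overline\Omega)$ and \<open>Du\<close> is its gradient: \<open>u\<close> and \<open>Du\<close> are continuous
  up to the boundary and \<open>Du\<close> is the gradient of \<open>u\<close> inside. On the boundary, \<open>Du\<close> is the
  continuous extension of the interior gradient. It is thus determined by \<open>u\<close> on the closure;
  the values of \<open>u\<close> and \<open>Du\<close> off the closure are irrelevant.\<close>

definition C1_closure_with_gradient ::
    "(real ^ 'n) set \<Rightarrow> (real ^ 'n \<Rightarrow> real) \<Rightarrow> (real ^ 'n \<Rightarrow> real ^ 'n) \<Rightarrow> bool" where
  "C1_closure_with_gradient \<Omega> u Du \<longleftrightarrow>
     continuous_on (closure \<Omega>) u \<and> continuous_on (closure \<Omega>) Du \<and>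
     (\<forall>x\<in>\<Omega>. GDERIV u x :> Du x)"

text \<open>Twice differentiability with Hessian matrix \<open>D2u x\<close> at each point of the open set \<open>\<Omega>\<close>,
  where \<open>Du\<close> is the gradient of \<open>u\<close> on \<open>\<Omega>\<close>: the gradient map is (Frechet) differentiable.\<close>

definition twice_differentiable_with_Hessian ::
    "(real ^ 'n) set \<Rightarrow> (real ^ 'n \<Rightarrow> real) \<Rightarrow> (real ^ 'n \<Rightarrow> real ^ 'n)
      \<Rightarrow> (real ^ 'n \<Rightarrow> real ^ 'n ^ 'n) \<Rightarrow> bool" where
  "twice_differentiable_with_Hessian \<Omega> u Du D2u \<longleftrightarrow>
     (\<forall>x\<in>\<Omega>. (GDERIV u x :> Du x) \<and> (Du has_derivative (\<lambda>h. D2u x *v h)) (at x))"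

definition below_boundary_tangents ::
    "(real ^ 'n) set \<Rightarrow> (real ^ 'n \<Rightarrow> real) \<Rightarrow> (real ^ 'n \<Rightarrow> real ^ 'n) \<Rightarrow> bool" where
  "below_boundary_tangents \<Omega> u Du \<longleftrightarrow>
     (\<forall>x\<in>frontier \<Omega>. \<forall>y\<in>closure \<Omega> - {x}. u y < u x + Du x \<bullet> (y - x))"

end

theory Submission
  imports Defs
begin

text \<open>
  Korevaar's concavity maximum principle. If \<open>u\<close> is not concave, the defect
  $\lambda u(x) + (1-\lambda) u(y) - u(z)$ with $z = \lambda x + (1-\lambda) y$ has a positive
  maximum over $x, y \in \overline\Omega$ and $\lambda \in [0,1]$. The tangent hyperplanes exclude
  $z \in \partial\Omega$ directly. If $z \in \Omega$, varying $\lambda$ shows that $Du(z)\cdot(y-x)$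
  equals $u(y)-u(x)$, while moving \<open>x\<close> towards \<open>z\<close> gives
  $Du(x)\cdot(y-x) \le Du(z)\cdot(y-x)$; so \<open>x\<close> is not on the boundary, and likewise \<open>y\<close>.
  If all three points are inside, the gradients coincide there, and a common translation of the
  three points gives $\lambda D^2u(x) + (1-\lambda) D^2u(y) \le D^2u(z)$. Ellipticity and concavity
  then turn the equation into $b(z,u(z),p) \le b(z,\lambda u(x)+(1-\lambda)u(y),p)$, which the
  strict monotonicity of \<open>b\<close> forbids.
\<close>

section \<open>The concavity defect and its positive maximum\<close>

text \<open>On a convex set, \<open>u\<close> is concave iff this is \<le> 0 for all weights in
  \<open>{0..1}\<close>. The weight is an argument because it is varied too in the
  maximization.\<close>

definition concavity_defect :: "('a::real_vector \<Rightarrow> real) \<Rightarrow> 'a \<Rightarrow> 'a \<Rightarrow> real \<Rightarrow> real" where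
  "concavity_defect u x y l = l * u x + (1 - l) * u y - u (l *\<^sub>R x + (1 - l) *\<^sub>R y)"

text \<open>This symmetry lets facts proved for the first end point be applied to the
  second.\<close>

lemma concavity_defect_commute: "concavity_defect u y x (1 - l) = concavity_defect u x y l"
  by (simp add: concavity_defect_def algebra_simps)

lemma continuous_on_concavity_defect:
  fixes S :: "'a::real_normed_vector set"
  assumes "convex S" and "continuous_on S u"
  shows "continuous_on (S \<times> S \<times> {0..1}) (\<lambda>(x, y, l). concavity_defect u x y l)"
proof -
  let ?K = "S \<times> S \<times> {0..1::real}"
  have "continuous_on ?K (\<lambda>p. u (fst p))" "continuous_on ?K (\<lambda>p. u (fst (snd p)))"
    by (rule continuous_on_compose2[OF assms(2)]; auto intro!: continuous_intros)+
  moreover have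
    "continuous_on ?K (\<lambda>p. u (snd (snd p) *\<^sub>R fst p + (1 - snd (snd p)) *\<^sub>R fst (snd p)))"
    by (rule continuous_on_compose2[OF assms(2)])
      (auto intro!: continuous_intros convexD[OF assms(1)])
  ultimately show ?thesis
    unfolding concavity_defect_def case_prod_unfold by (intro continuous_intros)
qed

text \<open>Compactness gives a maximum, and failure of concavity makes it positive. The defect
  vanishes for \<open>l = 0\<close>, \<open>l = 1\<close> and \<open>x = y\<close>, so the maximum
  avoids these degenerate cases.\<close>

lemma not_concave_imp_max_defect:
  fixes S :: "'a::real_normed_vector set"
  assumes "compact S" and "convex S" and "continuous_on S u" and "\<not> concave_on S u"
  obtains x y l where "x \<in> S" and "y \<in> S" and "0 < l" and "l < 1" and "x \<noteq> y"
    and "0 < concavity_defect u x y l"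
    and "\<And>x' y' l'. x' \<in> S \<Longrightarrow> y' \<in> S \<Longrightarrow> l' \<in> {0..1} \<Longrightarrow>
           concavity_defect u x' y' l' \<le> concavity_defect u x y l"
proof -
  let ?K = "S \<times> S \<times> {0..1::real}"
  from assms(2,4) obtain x0 y0 a b where 0: "x0 \<in> S" "y0 \<in> S" "a \<ge> 0" "b \<ge> 0" "a + b = 1"
      "u (a *\<^sub>R x0 + b *\<^sub>R y0) < a * u x0 + b * u y0"
    by (auto simp: concave_on_iff not_le)
  have "b = 1 - a" using 0 by simp
  with 0 have pos: "0 < concavity_defect u x0 y0 a" and K: "(x0, y0, a) \<in> ?K"
    by (auto simp: concavity_defect_def)
  have "\<exists>p\<in>?K. \<forall>q\<in>?K. (case q of (x, y, l) \<Rightarrow> concavity_defect u x y l)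
      \<le> (case p of (x, y, l) \<Rightarrow> concavity_defect u x y l)"
  proof (rule continuous_attains_sup[OF _ _ continuous_on_concavity_defect[OF assms(2,3)]])
    show "compact ?K" by (intro compact_Times assms compact_Icc)
    show "?K \<noteq> {}" using K by blast
  qed
  then obtain x y l where xyl: "x \<in> S" "y \<in> S" "l \<in> {0..1}"
    and max: "\<And>x' y' l'. x' \<in> S \<Longrightarrow> y' \<in> S \<Longrightarrow> l' \<in> {0..1} \<Longrightarrow>
           concavity_defect u x' y' l' \<le> concavity_defect u x y l"
    by fastforce
  have gt: "0 < concavity_defect u x y l"
    using max[of x0 y0 a] K pos by auto
  have "l \<noteq> 0" "l \<noteq> 1" using gt by (auto simp: concavity_defect_def)
  moreover have "x \<noteq> y" using gt by (auto simp: concavity_defect_def algebra_simps)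
  ultimately show thesis using that[OF xyl(1,2) _ _ _ gt max] xyl(3) by auto
qed

section \<open>Calculus along lines\<close>

lemma GDERIV_line:
  assumes "GDERIV u (a + t *\<^sub>R v) :> d"
  shows "((\<lambda>t. u (a + t *\<^sub>R v)) has_real_derivative (d \<bullet> v)) (at t)"
proof -
  have "((\<lambda>t. a + t *\<^sub>R v) has_derivative (\<lambda>s. s *\<^sub>R v)) (at t)"
    by (auto intro!: derivative_eq_intros)
  from has_derivative_compose[OF this, of u "\<lambda>h. h \<bullet> d"] assms
  show ?thesis
    by (simp add: gderiv_def has_field_derivative_def inner_commute mult_commute_abs)
qed

text \<open>With \<open>G\<close> the gradient of \<open>u\<close>, this produces the Hessian's
  quadratic form as a second derivative along a line.\<close>

lemma has_derivative_line_inner: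
  assumes "(G has_derivative L) (at a)"
  shows "((\<lambda>t. G (a + t *\<^sub>R h) \<bullet> h) has_real_derivative (L h \<bullet> h)) (at 0)"
proof -
  have "((\<lambda>t. a + t *\<^sub>R h) has_derivative (\<lambda>s. s *\<^sub>R h)) (at 0)"
    by (auto intro!: derivative_eq_intros)
  from has_derivative_compose[OF this, of G L] assms
  have "((\<lambda>t. G (a + t *\<^sub>R h)) has_derivative (\<lambda>s. L (s *\<^sub>R h))) (at 0)" by simp
  from has_derivative_inner_left[OF this, of h]
  show ?thesis
    by (simp add: has_field_derivative_def linear_cmul[OF has_derivative_linear[OF assms]]
        mult_commute_abs)
qed

text \<open>If \<open>c > 0\<close>, then \<open>g'\<close> is positive just to the right of 0 and
  \<open>g\<close> increases there. Only the differentiability of \<open>g'\<close> at 0 enters,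
  which suits a Hessian that may be discontinuous.\<close>

lemma second_derivative_nonpos_at_max:
  fixes g g' :: "real \<Rightarrow> real"
  assumes "0 < e" and g: "\<And>t. 0 \<le> t \<Longrightarrow> t < e \<Longrightarrow> (g has_real_derivative g' t) (at t)"
    and g': "(g' has_real_derivative c) (at 0)" and "g' 0 = 0"
    and max: "\<And>t. 0 \<le> t \<Longrightarrow> t < e \<Longrightarrow> g t \<le> g 0"
  shows "c \<le> 0"
proof (rule ccontr)
  assume "\<not> c \<le> 0"
  then obtain d where d: "d > 0" "\<And>t. 0 < t \<Longrightarrow> t < d \<Longrightarrow> 0 < g' t"
    using DERIV_pos_inc_right[OF g'] \<open>g' 0 = 0\<close> by auto
  define s where "s = min d e / 2"
  have s: "0 < s" "s < d" "s < e" using d(1) \<open>0 < e\<close> by (auto simp: s_def)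
  have "g 0 < g s"
  proof (rule DERIV_pos_imp_increasing_open[OF s(1)])
    show "\<exists>y. (g has_real_derivative y) (at t) \<and> 0 < y" if "0 < t" "t < s" for t
      using g[of t] d(2)[of t] that s by force
    show "continuous_on {0..s} g"
      by (rule DERIV_continuous_on, rule has_field_derivative_at_within, rule g) (use s in auto)
  qed
  with max[of s] s show False by simp
qed

section \<open>First-order conditions at a maximum\<close>

lemma convex_closure_combination_mem:
  fixes S :: "'a::euclidean_space set"
  assumes "convex S" and "open S" and "x \<in> closure S" and "y \<in> S" and "0 \<le> l" and "l < 1"
  shows "l *\<^sub>R x + (1 - l) *\<^sub>R y \<in> S"
  using mem_interior_closure_convex_shrink[OF assms(1), of y x "1 - l"] assms
  by (simp add: interior_open algebra_simps)

text \<open>The base point \<open>x\<close> may lie on the boundary, where only the continuous extension of the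
  gradient is available; hence the derivative is taken along segments entering the domain.\<close>

lemma max_defect_one_sided_gradient:
  fixes \<Omega> :: "(real ^ 'n) set"
  assumes "convex \<Omega>" and "open \<Omega>" and C1: "C1_closure_with_gradient \<Omega> u Du"
    and x: "x \<in> closure \<Omega>" and y: "y \<in> closure \<Omega>" and w: "w \<in> \<Omega>" and l: "0 < l" "l < 1"
    and max: "\<And>x'. x' \<in> closure \<Omega> \<Longrightarrow> concavity_defect u x' y l \<le> concavity_defect u x y l"
  shows "(Du x - Du (l *\<^sub>R x + (1 - l) *\<^sub>R y)) \<bullet> (w - x) \<le> 0"
proof (rule ccontr)
  define v where "v = w - x"
  define z where "z = l *\<^sub>R x + (1 - l) *\<^sub>R y"
  \<comment> \<open>Only \<open>x\<close> moves, with velocity \<open>v\<close>, so \<open>z\<close>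
    moves with velocity \<open>l *\<^sub>R v\<close>. Hence the derivative of \<open>h\<close> is
    \<open>l * k t\<close> for small \<open>t > 0\<close>, with \<open>k\<close> continuous up to
    \<open>t = 0\<close>.\<close>
  define h where "h = (\<lambda>t. l * u (x + t *\<^sub>R v) + (1 - l) * u y - u (z + t *\<^sub>R (l *\<^sub>R v)))"
  define k where "k = (\<lambda>t. (Du (x + t *\<^sub>R v) - Du (z + t *\<^sub>R (l *\<^sub>R v))) \<bullet> v)"
  assume "\<not> (Du x - Du (l *\<^sub>R x + (1 - l) *\<^sub>R y)) \<bullet> (w - x) \<le> 0"
  then have k0: "0 < k 0" by (simp add: k_def v_def z_def)
  from C1 have cu: "continuous_on (closure \<Omega>) u" and cD: "continuous_on (closure \<Omega>) Du"
    and D: "\<And>x. x \<in> \<Omega> \<Longrightarrow> GDERIV u x :> Du x"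
    by (auto simp: C1_closure_with_gradient_def)
  have cvx: "convex (closure \<Omega>)" using assms(1) by (rule convex_closure)
  have zt: "z + t *\<^sub>R (l *\<^sub>R v) = l *\<^sub>R (x + t *\<^sub>R v) + (1 - l) *\<^sub>R y" for t
    by (simp add: z_def algebra_simps)
  have h: "h t = concavity_defect u (x + t *\<^sub>R v) y l" for t
    unfolding h_def zt concavity_defect_def ..
  have in1: "x + t *\<^sub>R v \<in> \<Omega>" if "0 < t" "t \<le> 1" for t
    using convex_closure_combination_mem[OF assms(1,2) x w, of "1 - t"] that
    by (simp add: v_def algebra_simps)
  \<comment> \<open>Here \<open>y\<close> may lie on the boundary; the interior point is
    \<open>x + t *\<^sub>R v\<close>, whose weight \<open>l\<close> is positive.\<close>
  have in2: "z + t *\<^sub>R (l *\<^sub>R v) \<in> \<Omega>" if "0 < t" "t \<le> 1" for t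
    using convex_closure_combination_mem[OF assms(1,2) y in1[OF that], of "1 - l"] l
    unfolding zt by (simp add: add.commute)
  have cl1: "x + t *\<^sub>R v \<in> closure \<Omega>" if "t \<in> {0..1}" for t
    using in1[of t] x that closure_subset by (cases "t = 0") auto
  have cl2: "z + t *\<^sub>R (l *\<^sub>R v) \<in> closure \<Omega>" if "t \<in> {0..1}" for t
    unfolding zt using l by (intro convexD[OF cvx] cl1 that y) auto
  have "continuous_on {0..1} (\<lambda>t. u (x + t *\<^sub>R v))" "continuous_on {0..1} (\<lambda>t. Du (x + t *\<^sub>R v))"
    "continuous_on {0..1} (\<lambda>t. u (z + t *\<^sub>R (l *\<^sub>R v)))"
    "continuous_on {0..1} (\<lambda>t. Du (z + t *\<^sub>R (l *\<^sub>R v)))"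
    using cl1 cl2
    by (auto intro!: continuous_on_compose2[OF cu] continuous_on_compose2[OF cD] continuous_intros)
  then have ch: "continuous_on {0..1} h" and ck: "continuous_on {0..1} k"
    unfolding h_def k_def by (auto intro!: continuous_intros)
  obtain d where d: "0 < d" "\<And>t. t \<in> {0..1} \<Longrightarrow> dist t 0 < d \<Longrightarrow> dist (k t) (k 0) < k 0"
    using ck[unfolded continuous_on_iff, rule_format, of 0, OF _ k0] by force
  have kpos: "0 < k t" if "0 \<le> t" "t \<le> 1" "t < d" for t
    using d(2)[of t] that by (auto simp: dist_real_def)
  define s where "s = min (d / 2) 1"
  have s: "0 < s" "s < d" "s \<le> 1" using d(1) by (auto simp: s_def)
  \<comment> \<open>Differentiability is used only for \<open>0 < t < s\<close>; at 0 continuity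
    suffices, so \<open>x\<close> and \<open>z\<close> may lie on the boundary.\<close>
  have "h 0 < h s"
  proof (rule DERIV_pos_imp_increasing_open[OF s(1)])
    fix t assume t: "0 < t" "t < s"
    have "GDERIV u (x + t *\<^sub>R v) :> Du (x + t *\<^sub>R v)"
      "GDERIV u (z + t *\<^sub>R (l *\<^sub>R v)) :> Du (z + t *\<^sub>R (l *\<^sub>R v))"
      using t s by (intro D in1 in2; simp)+
    note this[THEN GDERIV_line, derivative_intros]
    have "(h has_real_derivative l * (Du (x + t *\<^sub>R v) \<bullet> v)
        - Du (z + t *\<^sub>R (l *\<^sub>R v)) \<bullet> (l *\<^sub>R v)) (at t)"
      unfolding h_def by (rule derivative_eq_intros refl)+ simp
    moreover have "l * (Du (x + t *\<^sub>R v) \<bullet> v) - Du (z + t *\<^sub>R (l *\<^sub>R v)) \<bullet> (l *\<^sub>R v) = l * k t"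
      by (simp add: k_def algebra_simps)
    ultimately show "\<exists>y. (h has_real_derivative y) (at t) \<and> 0 < y"
      using kpos[of t] t s l by (intro exI[of _ "l * k t"]) auto
  next
    show "continuous_on {0..s} h" using ch s by (auto intro: continuous_on_subset)
  qed
  moreover have "h s \<le> h 0" using max[OF cl1[of s]] s by (simp add: h)
  ultimately show False by simp
qed

text \<open>Around an interior \<open>x\<close> every direction is admissible in the one-sided
  inequality. Choosing the gradient difference \<open>g\<close> itself gives
  \<open>g \<bullet> g \<le> 0\<close>.\<close>

lemma max_defect_gradient_eq:
  fixes \<Omega> :: "(real ^ 'n) set"
  assumes "convex \<Omega>" and "open \<Omega>" and "C1_closure_with_gradient \<Omega> u Du"
    and x: "x \<in> \<Omega>" and "y \<in> closure \<Omega>" and "0 < l" and "l < 1"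
    and max: "\<And>x'. x' \<in> closure \<Omega> \<Longrightarrow> concavity_defect u x' y l \<le> concavity_defect u x y l"
  shows "Du x = Du (l *\<^sub>R x + (1 - l) *\<^sub>R y)"
proof (rule ccontr)
  define g where "g = Du x - Du (l *\<^sub>R x + (1 - l) *\<^sub>R y)"
  assume "Du x \<noteq> Du (l *\<^sub>R x + (1 - l) *\<^sub>R y)"
  then have g: "g \<noteq> 0" by (simp add: g_def)
  obtain e where e: "0 < e" "ball x e \<subseteq> \<Omega>" using x \<open>open \<Omega>\<close> open_contains_ball by blast
  \<comment> \<open>The step \<open>c *\<^sub>R g\<close> has length \<open>e / 2\<close>.\<close>
  define c where "c = e / (2 * norm g)"
  have c: "0 < c" using e g by (simp add: c_def)
  have "x + c *\<^sub>R g \<in> ball x e" using e g by (simp add: c_def dist_norm)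
  with e have "x + c *\<^sub>R g \<in> \<Omega>" by blast
  from max_defect_one_sided_gradient[OF assms(1-3) _ assms(5) this assms(6,7) max] x closure_subset
  have "g \<bullet> (c *\<^sub>R g) \<le> 0" by (auto simp: g_def)
  then have "c * (g \<bullet> g) \<le> 0" by simp
  moreover have "0 < c * (g \<bullet> g)" using c g by simp
  ultimately show False by simp
qed

text \<open>The maximizing weight is interior to the unit interval, so the derivative of the defect
  in the weight vanishes.\<close>

lemma max_defect_chord_slope:
  assumes D: "GDERIV u (l *\<^sub>R x + (1 - l) *\<^sub>R y) :> d" and l: "0 < l" "l < 1"
    and max: "\<And>l'. l' \<in> {0..1} \<Longrightarrow> concavity_defect u x y l' \<le> concavity_defect u x y l"
  shows "d \<bullet> (y - x) = u y - u x"
proof -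
  have eq: "m *\<^sub>R x + (1 - m) *\<^sub>R y = y + m *\<^sub>R (x - y)" for m
    by (simp add: algebra_simps)
  have "((\<lambda>m. concavity_defect u x y m) has_real_derivative (u x - u y - d \<bullet> (x - y))) (at l)"
    unfolding concavity_defect_def eq
    by (rule derivative_eq_intros GDERIV_line[OF D[unfolded eq]] refl)+ simp
  \<comment> \<open>The radius \<open>min l (1 - l)\<close> keeps \<open>m\<close> within the
    admissible weights.\<close>
  moreover have "\<forall>m. \<bar>l - m\<bar> < min l (1 - l) \<longrightarrow> concavity_defect u x y m \<le> concavity_defect u x y l"
    by (intro allI impI max) auto
  ultimately have "u x - u y - d \<bullet> (x - y) = 0"
    using l by (intro DERIV_local_max[of "concavity_defect u x y" _ l "min l (1 - l)"]) auto
  then show ?thesis by (simp add: inner_diff_right)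
qed

section \<open>Excluding the boundary\<close>

text \<open>At a boundary point \<open>x\<close>, the tangent hyperplane and the chord slope give
  \<open>Du z \<bullet> (y - x) < Du x \<bullet> (y - x)\<close>, where \<open>z\<close> is the
  intermediate point. The one-sided inequality in the direction of \<open>z\<close> gives the
  reverse.\<close>

lemma max_defect_not_frontier:
  fixes \<Omega> :: "(real ^ 'n) set"
  assumes "convex \<Omega>" and "open \<Omega>" and C1: "C1_closure_with_gradient \<Omega> u Du"
    and below: "below_boundary_tangents \<Omega> u Du"
    and x: "x \<in> closure \<Omega>" and y: "y \<in> closure \<Omega>" and "x \<noteq> y" and l: "0 < l" "l < 1"
    and z: "l *\<^sub>R x + (1 - l) *\<^sub>R y \<in> \<Omega>"
    and max: "\<And>x' l'. x' \<in> closure \<Omega> \<Longrightarrow> l' \<in> {0..1} \<Longrightarrow>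
           concavity_defect u x' y l' \<le> concavity_defect u x y l"
  shows "x \<in> \<Omega>"
proof (rule ccontr)
  let ?z = "l *\<^sub>R x + (1 - l) *\<^sub>R y"
  assume "x \<notin> \<Omega>"
  then have "x \<in> frontier \<Omega>" using x \<open>open \<Omega>\<close> by (simp add: frontier_def interior_open)
  with below y \<open>x \<noteq> y\<close> have "u y < u x + Du x \<bullet> (y - x)"
    unfolding below_boundary_tangents_def by blast
  moreover have "Du ?z \<bullet> (y - x) = u y - u x"
  proof (rule max_defect_chord_slope[OF _ l])
    show "GDERIV u ?z :> Du ?z" using C1 z by (simp add: C1_closure_with_gradient_def)
  qed (rule max[OF x])
  moreover have "(Du x - Du ?z) \<bullet> (?z - x) \<le> 0"
    using l by (intro max_defect_one_sided_gradient[OF assms(1-3) x y z l] max) auto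
  moreover have "?z - x = (1 - l) *\<^sub>R (y - x)" by (simp add: algebra_simps)
  ultimately have "(1 - l) * ((Du x - Du ?z) \<bullet> (y - x)) \<le> 0" and "0 < (Du x - Du ?z) \<bullet> (y - x)"
    by (simp_all add: inner_diff_left)
  with l show False by (simp add: mult_le_0_iff)
qed

text \<open>If the intermediate point \<open>z\<close> were on the boundary, its tangent
  inequalities at \<open>x\<close> and \<open>y\<close> could be averaged with weights
  \<open>l\<close> and \<open>1 - l\<close>. The gradient terms cancel, leaving a negative
  defect.\<close>

lemma positive_defect_not_frontier:
  fixes \<Omega> :: "(real ^ 'n) set"
  assumes "convex \<Omega>" and "open \<Omega>" and below: "below_boundary_tangents \<Omega> u Du"
    and x: "x \<in> closure \<Omega>" and y: "y \<in> closure \<Omega>" and "x \<noteq> y" and l: "0 < l" "l < 1"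
    and pos: "0 < concavity_defect u x y l"
  shows "l *\<^sub>R x + (1 - l) *\<^sub>R y \<in> \<Omega>" (is "?z \<in> \<Omega>")
proof (rule ccontr)
  assume "?z \<notin> \<Omega>"
  moreover have "?z \<in> closure \<Omega>"
    using l x y by (intro convexD[OF convex_closure[OF assms(1)]]) auto
  ultimately have "?z \<in> frontier \<Omega>"
    using \<open>open \<Omega>\<close> by (simp add: frontier_def interior_open)
  have zx: "x - ?z = (1 - l) *\<^sub>R (x - y)" and zy: "y - ?z = (- l) *\<^sub>R (x - y)"
    by (simp_all add: algebra_simps)
  then have "x \<noteq> ?z" "y \<noteq> ?z" using l \<open>x \<noteq> y\<close> by auto
  with below \<open>?z \<in> frontier \<Omega>\<close> x y
  have "u x < u ?z + Du ?z \<bullet> (x - ?z)" "u y < u ?z + Du ?z \<bullet> (y - ?z)"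
    unfolding below_boundary_tangents_def by blast+
  then have "l * u x < l * (u ?z + Du ?z \<bullet> (x - ?z))"
    "(1 - l) * u y < (1 - l) * (u ?z + Du ?z \<bullet> (y - ?z))"
    using l by auto
  then have "l * u x + (1 - l) * u y
      < l * (u ?z + Du ?z \<bullet> (x - ?z)) + (1 - l) * (u ?z + Du ?z \<bullet> (y - ?z))"
    by linarith
  also have "\<dots> = u ?z" unfolding zx zy by (simp add: algebra_simps)
  finally show False using pos by (simp add: concavity_defect_def)
qed

section \<open>Second-order condition at an interior maximum\<close>

text \<open>Translating \<open>x\<close> and \<open>y\<close> by the same
  \<open>t *\<^sub>R h\<close> translates the intermediate point likewise. The defect is then a
  function of \<open>t\<close> alone, critical at 0 because the gradients agree, and its second
  derivative there is the difference of the two sides.\<close>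

lemma max_defect_Hessian_le:
  fixes \<Omega> :: "(real ^ 'n) set"
  assumes "open \<Omega>" and D2: "twice_differentiable_with_Hessian \<Omega> u Du D2u"
    and x: "x \<in> \<Omega>" and y: "y \<in> \<Omega>" and z: "l *\<^sub>R x + (1 - l) *\<^sub>R y \<in> \<Omega>"
    and Du_eq: "Du x = Du (l *\<^sub>R x + (1 - l) *\<^sub>R y)" "Du y = Du (l *\<^sub>R x + (1 - l) *\<^sub>R y)"
    and max: "\<And>x' y'. x' \<in> \<Omega> \<Longrightarrow> y' \<in> \<Omega> \<Longrightarrow> concavity_defect u x' y' l \<le> concavity_defect u x y l"
  shows "h \<bullet> ((l *\<^sub>R D2u x + (1 - l) *\<^sub>R D2u y) *v h) \<le> h \<bullet> (D2u (l *\<^sub>R x + (1 - l) *\<^sub>R y) *v h)"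
proof -
  define z where "z = l *\<^sub>R x + (1 - l) *\<^sub>R y"
  define g where "g = (\<lambda>t. l * u (x + t *\<^sub>R h) + (1 - l) * u (y + t *\<^sub>R h) - u (z + t *\<^sub>R h))"
  define g' where "g' = (\<lambda>t. l * (Du (x + t *\<^sub>R h) \<bullet> h) + (1 - l) * (Du (y + t *\<^sub>R h) \<bullet> h)
      - Du (z + t *\<^sub>R h) \<bullet> h)"
  have D: "GDERIV u w :> Du w" and H: "(Du has_derivative (\<lambda>h. D2u w *v h)) (at w)"
    if "w \<in> \<Omega>" for w
    using D2 that by (auto simp: twice_differentiable_with_Hessian_def)
  have "\<forall>\<^sub>F t in nhds 0. w + t *\<^sub>R h \<in> \<Omega>" if "w \<in> \<Omega>" for w
  proof -
    have "((\<lambda>t. w + t *\<^sub>R h) \<longlongrightarrow> w + 0 *\<^sub>R h) (nhds (0::real))"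
      by (intro tendsto_intros filterlim_ident)
    with \<open>open \<Omega>\<close> that show ?thesis by (intro topological_tendstoD) auto
  qed
  from this[OF x] this[OF y] this[OF z]
  have "\<forall>\<^sub>F t in nhds (0::real). x + t *\<^sub>R h \<in> \<Omega> \<and> y + t *\<^sub>R h \<in> \<Omega> \<and> z + t *\<^sub>R h \<in> \<Omega>"
    unfolding z_def by eventually_elim auto
  then obtain e where "0 < e"
    and e: "\<And>t. dist t 0 < e \<Longrightarrow> x + t *\<^sub>R h \<in> \<Omega> \<and> y + t *\<^sub>R h \<in> \<Omega> \<and> z + t *\<^sub>R h \<in> \<Omega>"
    unfolding eventually_nhds_metric by blast
  have g_defect: "g t = concavity_defect u (x + t *\<^sub>R h) (y + t *\<^sub>R h) l" for t
  proof -
    have "z + t *\<^sub>R h = l *\<^sub>R (x + t *\<^sub>R h) + (1 - l) *\<^sub>R (y + t *\<^sub>R h)"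
      by (simp add: z_def algebra_simps)
    then show ?thesis by (simp add: g_def concavity_defect_def)
  qed
  let ?c = "l * ((D2u x *v h) \<bullet> h) + (1 - l) * ((D2u y *v h) \<bullet> h) - (D2u z *v h) \<bullet> h"
  have "?c \<le> 0"
  proof (rule second_derivative_nonpos_at_max[OF \<open>0 < e\<close>, of g g'])
    show "(g has_real_derivative g' t) (at t)" if "0 \<le> t" "t < e" for t
      unfolding g_def g'_def
      using e[of t] that
      by (auto intro!: derivative_eq_intros GDERIV_line[OF D])
    show "(g' has_real_derivative ?c) (at 0)"
      unfolding g'_def using x y z
      by (auto intro!: derivative_eq_intros has_derivative_line_inner H simp: z_def)
    show "g' 0 = 0" using Du_eq by (simp add: g'_def z_def algebra_simps)
    show "g t \<le> g 0" if "0 \<le> t" "t < e" for t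
      using max e[of t] that by (simp add: g_defect)
  qed
  then show ?thesis
    by (simp add: z_def matrix_vector_mult_add_rdistrib scaleR_matrix_vector_assoc[symmetric]
        inner_add_right inner_commute)
qed

section \<open>Contradiction between the equation and a positive maximum\<close>

theorem theorem1p1:
  fixes \<Omega> :: "(real ^ 'n) set"
    and \<Gamma> :: "(real ^ 'n ^ 'n) set"
    and f :: "real ^ 'n \<Rightarrow> real ^ 'n ^ 'n \<Rightarrow> real"
    and b :: "real ^ 'n \<Rightarrow> real \<Rightarrow> real ^ 'n \<Rightarrow> real"
    and u :: "real ^ 'n \<Rightarrow> real"
    and Du :: "real ^ 'n \<Rightarrow> real ^ 'n"
    and D2u :: "real ^ 'n \<Rightarrow> real ^ 'n ^ 'n"
  assumes "bounded \<Omega>" and "convex \<Omega>" and "open \<Omega>"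
    and "convex \<Gamma>" and "openin (top_of_set sym_matrices) \<Gamma>"
    and weak_ellipticity:
      "\<And>p r s. r \<in> \<Gamma> \<Longrightarrow> s \<in> \<Gamma> \<Longrightarrow> loewner_le s r \<Longrightarrow> f p s \<le> f p r"
    and concavity:
      "\<And>p r s l. r \<in> \<Gamma> \<Longrightarrow> s \<in> \<Gamma> \<Longrightarrow> l \<in> {0..1} \<Longrightarrow>
         f p (l *\<^sub>R r + (1 - l) *\<^sub>R s) \<ge> l * f p r + (1 - l) * f p s"
    and monotonicity:
      "\<And>x p z w. x \<in> \<Omega> \<Longrightarrow> z > w \<Longrightarrow> b x z p < b x w p"
    and joint_concavity:
      "\<And>x y z w p l. x \<in> \<Omega> \<Longrightarrow> y \<in> \<Omega> \<Longrightarrow> l \<in> {0..1} \<Longrightarrow>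
         b (l *\<^sub>R x + (1 - l) *\<^sub>R y) (l * z + (1 - l) * w) p \<ge> l * b x z p + (1 - l) * b y w p"
    and "C1_closure_with_gradient \<Omega> u Du"
    and "twice_differentiable_with_Hessian \<Omega> u Du D2u"
    and "\<And>x. x \<in> \<Omega> \<Longrightarrow> D2u x \<in> \<Gamma>"
    and equation: "\<And>x. x \<in> \<Omega> \<Longrightarrow> - f (Du x) (D2u x) = b x (u x) (Du x)"
    and "below_boundary_tangents \<Omega> u Du"
  shows "concave_on (closure \<Omega>) u"
proof (rule ccontr)
  assume nc: "\<not> concave_on (closure \<Omega>) u"
  note C1 = \<open>C1_closure_with_gradient \<Omega> u Du\<close>
  note below = \<open>below_boundary_tangents \<Omega> u Du\<close>
  note cvx = \<open>convex \<Omega>\<close> and opn = \<open>open \<Omega>\<close>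
  have "compact (closure \<Omega>)" "convex (closure \<Omega>)" "continuous_on (closure \<Omega>) u"
    using \<open>bounded \<Omega>\<close> cvx C1 by (auto simp: C1_closure_with_gradient_def)
  then obtain x y l where xc: "x \<in> closure \<Omega>" and yc: "y \<in> closure \<Omega>" and l: "0 < l" "l < 1"
    and "x \<noteq> y" and pos: "0 < concavity_defect u x y l"
    and max: "\<And>x' y' l'. x' \<in> closure \<Omega> \<Longrightarrow> y' \<in> closure \<Omega> \<Longrightarrow> l' \<in> {0..1} \<Longrightarrow>
           concavity_defect u x' y' l' \<le> concavity_defect u x y l"
    by (rule not_concave_imp_max_defect[OF _ _ _ nc]) blast
  define z where "z = l *\<^sub>R x + (1 - l) *\<^sub>R y"
  have z_swap: "z = (1 - l) *\<^sub>R y + (1 - (1 - l)) *\<^sub>R x" by (simp add: z_def)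
  \<comment> \<open>Exchanging the end points reflects the weight, so \<open>(y, x, 1 - l)\<close>
    is a maximum as well and the lemmas on the first end point apply to \<open>y\<close>.\<close>
  have max_swap: "concavity_defect u y' x l' \<le> concavity_defect u y x (1 - l)"
    if "y' \<in> closure \<Omega>" "l' \<in> {0..1}" for y' l'
    using max[of x y' "1 - l'"] xc that concavity_defect_commute[of u x y' l']
      concavity_defect_commute[of u y x l] by auto
  have l': "0 < 1 - l" "1 - l < 1" "l \<in> {0..1}" "1 - l \<in> {0..1}" using l by auto
  have z: "z \<in> \<Omega>"
    unfolding z_def by (rule positive_defect_not_frontier[OF cvx opn below xc yc \<open>x \<noteq> y\<close> l pos])
  have x: "x \<in> \<Omega>"
    using z unfolding z_def
    by (rule max_defect_not_frontier[OF cvx opn C1 below xc yc \<open>x \<noteq> y\<close> l]) (rule max[OF _ yc])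
  have y: "y \<in> \<Omega>"
    using z unfolding z_swap
    by (rule max_defect_not_frontier[OF cvx opn C1 below yc xc \<open>x \<noteq> y\<close>[symmetric] l'(1,2)])
      (rule max_swap)
  have Dx: "Du x = Du z"
    unfolding z_def by (rule max_defect_gradient_eq[OF cvx opn C1 x yc l]) (rule max[OF _ yc l'(3)])
  have Dy: "Du y = Du z"
    unfolding z_swap
    by (rule max_defect_gradient_eq[OF cvx opn C1 y xc l'(1,2)]) (rule max_swap[OF _ l'(4)])
  let ?p = "Du z" and ?r = "l *\<^sub>R D2u x + (1 - l) *\<^sub>R D2u y"
  have \<Gamma>: "D2u x \<in> \<Gamma>" "D2u y \<in> \<Gamma>" "D2u z \<in> \<Gamma>"
    using x y z \<open>\<And>x. x \<in> \<Omega> \<Longrightarrow> D2u x \<in> \<Gamma>\<close> by auto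
  have r: "?r \<in> \<Gamma>" using \<Gamma> l by (intro convexD[OF \<open>convex \<Gamma>\<close>]) auto
  have "\<Gamma> \<subseteq> sym_matrices"
    using \<open>openin (top_of_set sym_matrices) \<Gamma>\<close> openin_imp_subset by blast
  with r \<Gamma> have "transpose ?r = ?r" "transpose (D2u z) = D2u z" by (auto simp: sym_matrices_def)
  \<comment> \<open>\<open>psd\<close> includes symmetry, so the inequality of quadratic forms alone
    would not give the matrix order.\<close>
  then have "D2u z - ?r \<in> sym_matrices"
    by (simp add: sym_matrices_def transpose_def vec_eq_iff)
  moreover have "h \<bullet> (?r *v h) \<le> h \<bullet> (D2u z *v h)" for h
    using z Dx Dy unfolding z_def
  proof (rule max_defect_Hessian_le[OF opn \<open>twice_differentiable_with_Hessian \<Omega> u Du D2u\<close> x y])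
    show "concavity_defect u x' y' l \<le> concavity_defect u x y l" if "x' \<in> \<Omega>" "y' \<in> \<Omega>" for x' y'
      using that closure_subset l'(3) by (intro max) auto
  qed
  ultimately have "loewner_le ?r (D2u z)"
    by (simp add: loewner_le_def psd_def matrix_vector_mult_diff_rdistrib inner_diff_right)
  then have "f ?p ?r \<le> f ?p (D2u z)" using weak_ellipticity \<Gamma> r by blast
  moreover have "l * f ?p (D2u x) + (1 - l) * f ?p (D2u y) \<le> f ?p ?r"
    using concavity \<Gamma> l' by blast
  moreover have "f ?p (D2u x) = - b x (u x) ?p" "f ?p (D2u y) = - b y (u y) ?p"
    "f ?p (D2u z) = - b z (u z) ?p"
    using equation[OF x] equation[OF y] equation[OF z] by (simp_all add: Dx Dy)
  \<comment> \<open>Ellipticity and concavity bound \<open>f ?p (D2u z)\<close> below by the average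
    of the values at \<open>x\<close> and \<open>y\<close>; the equation reverses the sign. All
    three gradients equal \<open>?p\<close>, as concavity of \<open>f\<close> and \<open>b\<close>
    is available only for a fixed gradient argument.\<close>
  ultimately have "b z (u z) ?p \<le> l * b x (u x) ?p + (1 - l) * b y (u y) ?p" by simp
  also have "\<dots> \<le> b z (l * u x + (1 - l) * u y) ?p"
    using joint_concavity[OF x y l'(3)] by (simp add: z_def)
  \<comment> \<open>A positive defect says that \<open>u z\<close> is smaller than the average of
    \<open>u x\<close> and \<open>u y\<close>, and \<open>b\<close> is strictly decreasing in this
    argument.\<close>
  also have "\<dots> < b z (u z) ?p"
    using pos by (intro monotonicity z) (simp add: concavity_defect_def z_def)
  finally show False by simp
qed

end
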